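(* Consider a two-way parking lot instance. Let $\mathcal{F}^{\mathrm{flow}}_{2W}$ be the flow-based formulation in variables $(x,y,f)$ and $\mathcal{F}^{\mathrm{CCC}}_{2W}$ the connectivity-cut formulation in variables $(x,y)$, both defined in the context. Here $(x,y)$ denotes an integer feasible parking and driving-field assignment, with $x=(x^0,x^{90})$. Then the two formulations induce the same set of integer feasible values for $(x,y)$. That is, for every binary vector $(x,y)$, there exists $f$ such that $(x,y,f)$ is feasible for $\mathcal{F}^{\mathrm{flow}}_{2W}$ if and only if $(x,y)$ is feasible for $\mathcal{F}^{\mathrm{CCC}}_{2W}$.
   Context: **Lot and fields.** Let $\mu,\nu,\omega,\ell,\delta$ be positive integers with $\delta\ge 2\omega$. The lot is $L=\{(i,j): 0\le i\le \mu-1,\ 0\le j\le \nu-1\}$, and $B\subseteq L$ is the set of blocked cells. A $0^\circ$ parking field anchored at $(i,j)$ consists of the cells $(i+k,j+l)$ with $0\le k\le\omega-1$, $0\le l\le \ell-1$. A $90^\circ$ parking field anchored at $(i,j)$ consists of the cells $(i+k,j+l)$ with $0\le k\le\ell-1$, $0\le l\le\omega-1$. A driving field anchored at $(i,j)$ consists of the cells $(i+k,j+l)$ with $0\le k,l\le\delta-1$. The sets $P^0,P^{90},D\subseteq L$ are the sets of valid anchors of $0^\circ$ parking, $90^\circ$ parking and driving fields; every field anchored at a valid anchor is contained in $L\setminus B$. The entrance/exit is a driving field anchored at $(p,q)\in D$. $Q\subseteq D$ is the set of anchors of existing driving fields. **Graph.** $G=(D,A)$ is the directed graph whose arcs $A$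 are all ordered pairs of cells of $D$ that share a side (so arcs occur in both directions). $G$ is assumed strongly connected (cells of the lot from which the entrance cannot be reached are not valid). $D_{ij}$ is the set of heads of arcs leaving $(i,j)$, and $D^{-1}_{ij}$ the set of tails of arcs entering $(i,j)$. Put $M=|D|-1$. **Incidence sets.** $\mathcal{P}^0_{ij}$, $\mathcal{P}^{90}_{ij}$, $\mathcal{D}_{ij}$ are the sets of anchors in $P^0$, $P^{90}$, $D$, respectively, whose field contains the cell $(i,j)$. The accessing driving anchors (those whose driving field abuts an entire shorter edge of the parking field) are $N^0_{ij}=D\cap\{(k,l): i+\omega-\delta\le k\le i,\ l\in\{j-\delta,\,j+\ell\}\}$ and $N^{90}_{ij}=D\cap\{(k,l): k\in\{i-\delta,\,i+\ell\},\ j+\omega-\delta\le l\le j\}$. **Formulation $\mathcal{F}^{\mathrm{flow}}_{2W}$.** Variables $x^0_{ij}\in\{0,1\}$ for $(i,j)\in P^0$, $x^{90}_{ij}\in\{0,1\}$ for $(i,j)\in P^{90}$, $y_{ij}\in\{0,1\}$ for $(i,j)\in D$, and $f_{ij,kl}\ge0$ for $((i,j),(k,l))\in A$. Maximize $\sum_{P^0}x^0_{ij}+\sum_{P^{90}}x^{90}_{ij}$ subject to: 1. $y_{mn}+\sum_{(k,l)\in\mathcal{P}^0_{ij}}x^0_{kl}+\sum_{(k,l)\in\mathcal{P}^{90}_{ij}}x^{90}_{kl}\le1$ for all $(i,j)\in L\setminus B$ and $(m,n)\in\mathcal{D}_{ij}$ (if $\mathcal{D}_{ij}=\emptyset$,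 the same constraint without the $y$ term is imposed); 2. $x^0_{ij}\le\sum_{(k,l)\in N^0_{ij}}y_{kl}$ for all $(i,j)\in P^0$, and $x^{90}_{ij}\le\sum_{(k,l)\in N^{90}_{ij}}y_{kl}$ for all $(i,j)\in P^{90}$; 3. $\sum_{(k,l)\in D_{ij}}f_{ij,kl}-\sum_{(k,l)\in D^{-1}_{ij}}f_{kl,ij}=y_{ij}$ for all $(i,j)\in D\setminus\{(p,q)\}$; 4. $\sum_{(i,j)\in D^{-1}_{pq}}f_{ij,pq}=\sum_{(i,j)\in D}y_{ij}-1$; 5. $f_{ij,kl}\le My_{ij}$ and $f_{ij,kl}\le My_{kl}$ for all $((i,j),(k,l))\in A$; 6. $y_{ij}=1$ for all $(i,j)\in Q\cup\{(p,q)\}$. **Vertex cut sets.** A vertex cut set (vertex separator) is a set $V\subseteq D$ whose removal from $G$ leaves exactly two (disconnected) components, with the entrance $(p,q)$ in one of them. $V_{pq}$ is the node set of the component containing $(p,q)$, and $V'_{pq}=D\setminus(V_{pq}\cup V)\neq\emptyset$. It is also required that every cell of $V$ be adjacent to at least one cell of $V'_{pq}$. $\mathcal{V}_{pq}$ is the collection of all such $V$. For $S\subseteq D$ define $\mathcal{P}^0_{ij}(S)=\{(k,l)\in\mathcal{P}^0_{ij}:N^0_{kl}\subseteq S\}$, $\mathcal{P}^{90}_{ij}(S)=\{(k,l)\in\mathcal{P}^{90}_{ij}:N^{90}_{kl}\subseteq S\}$ and $\mathcal{D}_{ij}(S)=\mathcal{D}_{ij}\cap S$. **Formulation $\mathcal{F}^{\mathrm{CCC}}_{2W}$.**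 Same objective, binary variables $x^0,x^{90},y$ only, subject to constraints 1, 2, 6 above and $$y_{mn}+\sum_{(k,l)\in\mathcal{P}^0_{ij}(V'_{pq}\cup V)}x^0_{kl}+\sum_{(k,l)\in\mathcal{P}^{90}_{ij}(V'_{pq}\cup V)}x^{90}_{kl}\le\sum_{(k,l)\in V}y_{kl}$$ for all $V\in\mathcal{V}_{pq}$, $(i,j)\in V'_{pq}$, $(m,n)\in\mathcal{D}_{ij}(V'_{pq})$.
   Formalization: A vertex cut set need not leave exactly two components: the part V'_pq not containing the entrance only has to be nonempty and may be disconnected. With exactly two components the claim fails, e.g. when D is a cell and three of its neighbours, one of them the entrance. *)

theory Defs
  imports Complex_Main "Graph_Theory.Graph_Theory"
begin

type_synonym cell = "int \<times> int"

text \<open>Integer coordinates are used so that expressions such as \<open>j - \<delta>\<close> are not truncated.\<close>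

record parking_lot =
  lot_rows :: int            (* mu *)
  lot_cols :: int            (* nu *)
  park_width :: int          (* omega *)
  park_length :: int         (* ell *)
  drive_size :: int          (* delta *)
  blocked :: "cell set"      (* B *)
  anchors0 :: "cell set"     (* P^0 *)
  anchors90 :: "cell set"    (* P^90 *)
  anchorsD :: "cell set"     (* D *)
  entrance :: cell           (* (p,q) *)
  existing :: "cell set"     (* Q *)

definition lot :: "parking_lot \<Rightarrow> cell set" where
  "lot I = {0..lot_rows I - 1} \<times> {0..lot_cols I - 1}"

fun field0 :: "parking_lot \<Rightarrow> cell \<Rightarrow> cell set" where
  "field0 I (i, j) = {i..i + park_width I - 1} \<times> {j..j + park_length I - 1}"

fun field90 :: "parking_lot \<Rightarrow> cell \<Rightarrow> cell set" where
  "field90 I (i, j) = {i..i + park_length I - 1} \<times> {j..j + park_width I - 1}"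

fun fieldD :: "parking_lot \<Rightarrow> cell \<Rightarrow> cell set" where
  "fieldD I (i, j) = {i..i + drive_size I - 1} \<times> {j..j + drive_size I - 1}"

fun share_side :: "cell \<Rightarrow> cell \<Rightarrow> bool" where
  "share_side (i, j) (k, l) \<longleftrightarrow> \<bar>i - k\<bar> + \<bar>j - l\<bar> = 1"

definition drive_arcs :: "parking_lot \<Rightarrow> (cell \<times> cell) set" where
  "drive_arcs I = {(a, b). a \<in> anchorsD I \<and> b \<in> anchorsD I \<and> share_side a b}"

definition drive_graph :: "parking_lot \<Rightarrow> cell pair_pre_digraph" where
  "drive_graph I = \<lparr> pverts = anchorsD I, parcs = drive_arcs I \<rparr>"

definition out_heads :: "parking_lot \<Rightarrow> cell \<Rightarrow> cell set" where
  "out_heads I a = {b. (a, b) \<in> drive_arcs I}"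

definition in_tails :: "parking_lot \<Rightarrow> cell \<Rightarrow> cell set" where
  "in_tails I a = {b. (b, a) \<in> drive_arcs I}"

definition two_way_instance :: "parking_lot \<Rightarrow> bool" where
  "two_way_instance I \<longleftrightarrow>
     lot_rows I > 0 \<and> lot_cols I > 0 \<and> park_width I > 0 \<and> park_length I > 0 \<and>
     drive_size I > 0 \<and> drive_size I \<ge> 2 * park_width I \<and>
     blocked I \<subseteq> lot I \<and>
     anchors0 I \<subseteq> lot I \<and> (\<forall>a\<in>anchors0 I. field0 I a \<subseteq> lot I - blocked I) \<and>
     anchors90 I \<subseteq> lot I \<and> (\<forall>a\<in>anchors90 I. field90 I a \<subseteq> lot I - blocked I) \<and>
     anchorsD I \<subseteq> lot I \<and> (\<forall>a\<in>anchorsD I. fieldD I a \<subseteq> lot I - blocked I) \<and>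
     entrance I \<in> anchorsD I \<and>
     existing I \<subseteq> anchorsD I \<and>
     strongly_connected (with_proj (drive_graph I))"

definition cover0 :: "parking_lot \<Rightarrow> cell \<Rightarrow> cell set" where
  "cover0 I c = {a \<in> anchors0 I. c \<in> field0 I a}"

definition cover90 :: "parking_lot \<Rightarrow> cell \<Rightarrow> cell set" where
  "cover90 I c = {a \<in> anchors90 I. c \<in> field90 I a}"

definition coverD :: "parking_lot \<Rightarrow> cell \<Rightarrow> cell set" where
  "coverD I c = {a \<in> anchorsD I. c \<in> fieldD I a}"

fun access0 :: "parking_lot \<Rightarrow> cell \<Rightarrow> cell set" where
  "access0 I (i, j) = anchorsD I \<inter>
     {(k, l). i + park_width I - drive_size I \<le> k \<and> k \<le> i \<and>
              l \<in> {j - drive_size I, j + park_length I}}"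

fun access90 :: "parking_lot \<Rightarrow> cell \<Rightarrow> cell set" where
  "access90 I (i, j) = anchorsD I \<inter>
     {(k, l). k \<in> {i - drive_size I, i + park_length I} \<and>
              j + park_width I - drive_size I \<le> l \<and> l \<le> j}"

definition cover0_within :: "parking_lot \<Rightarrow> cell set \<Rightarrow> cell \<Rightarrow> cell set" where
  "cover0_within I S c = {a \<in> cover0 I c. access0 I a \<subseteq> S}"

definition cover90_within :: "parking_lot \<Rightarrow> cell set \<Rightarrow> cell \<Rightarrow> cell set" where
  "cover90_within I S c = {a \<in> cover90 I c. access90 I a \<subseteq> S}"

definition coverD_within :: "parking_lot \<Rightarrow> cell set \<Rightarrow> cell \<Rightarrow> cell set" where
  "coverD_within I S c = coverD I c \<inter> S"

text \<open>
  The variables are total functions, of which only the values on the respective index sets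
  (\<open>P\<^sup>0\<close>, \<open>P\<^sup>9\<^sup>0\<close>, \<open>D\<close> and the arc set) matter.
\<close>

definition binary_vector ::
  "parking_lot \<Rightarrow> (cell \<Rightarrow> real) \<Rightarrow> (cell \<Rightarrow> real) \<Rightarrow> (cell \<Rightarrow> real) \<Rightarrow> bool" where
  "binary_vector I x0 x90 y \<longleftrightarrow>
     (\<forall>a\<in>anchors0 I. x0 a \<in> {0, 1}) \<and>
     (\<forall>a\<in>anchors90 I. x90 a \<in> {0, 1}) \<and>
     (\<forall>a\<in>anchorsD I. y a \<in> {0, 1})"

definition packing_constraints ::
  "parking_lot \<Rightarrow> (cell \<Rightarrow> real) \<Rightarrow> (cell \<Rightarrow> real) \<Rightarrow> (cell \<Rightarrow> real) \<Rightarrow> bool" where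
  "packing_constraints I x0 x90 y \<longleftrightarrow>
     (\<forall>c \<in> lot I - blocked I.
        (\<forall>d \<in> coverD I c. y d + (\<Sum>a\<in>cover0 I c. x0 a) + (\<Sum>a\<in>cover90 I c. x90 a) \<le> 1) \<and>
        (coverD I c = {} \<longrightarrow> (\<Sum>a\<in>cover0 I c. x0 a) + (\<Sum>a\<in>cover90 I c. x90 a) \<le> 1))"

definition access_constraints ::
  "parking_lot \<Rightarrow> (cell \<Rightarrow> real) \<Rightarrow> (cell \<Rightarrow> real) \<Rightarrow> (cell \<Rightarrow> real) \<Rightarrow> bool" where
  "access_constraints I x0 x90 y \<longleftrightarrow>
     (\<forall>a\<in>anchors0 I. x0 a \<le> (\<Sum>d\<in>access0 I a. y d)) \<and>
     (\<forall>a\<in>anchors90 I. x90 a \<le> (\<Sum>d\<in>access90 I a. y d))"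

definition fixing_constraints :: "parking_lot \<Rightarrow> (cell \<Rightarrow> real) \<Rightarrow> bool" where
  "fixing_constraints I y \<longleftrightarrow> (\<forall>d \<in> existing I \<union> {entrance I}. y d = 1)"

definition flow_constraints ::
  "parking_lot \<Rightarrow> (cell \<Rightarrow> real) \<Rightarrow> (cell \<times> cell \<Rightarrow> real) \<Rightarrow> bool" where
  "flow_constraints I y f \<longleftrightarrow>
     (\<forall>e \<in> drive_arcs I. f e \<ge> 0) \<and>
     (\<forall>a \<in> anchorsD I - {entrance I}.
        (\<Sum>b\<in>out_heads I a. f (a, b)) - (\<Sum>b\<in>in_tails I a. f (b, a)) = y a) \<and>
     (\<Sum>b\<in>in_tails I (entrance I). f (b, entrance I)) = (\<Sum>a\<in>anchorsD I. y a) - 1 \<and>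
     (\<forall>(a, b) \<in> drive_arcs I.
        f (a, b) \<le> (real (card (anchorsD I)) - 1) * y a \<and>
        f (a, b) \<le> (real (card (anchorsD I)) - 1) * y b)"

definition flow_feasible ::
  "parking_lot \<Rightarrow> (cell \<Rightarrow> real) \<Rightarrow> (cell \<Rightarrow> real) \<Rightarrow> (cell \<Rightarrow> real) \<Rightarrow> (cell \<times> cell \<Rightarrow> real) \<Rightarrow> bool"
where
  "flow_feasible I x0 x90 y f \<longleftrightarrow>
     binary_vector I x0 x90 y \<and>
     packing_constraints I x0 x90 y \<and>
     access_constraints I x0 x90 y \<and>
     flow_constraints I y f \<and>
     fixing_constraints I y"

definition entrance_component :: "parking_lot \<Rightarrow> cell set \<Rightarrow> cell set" where
  "entrance_component I V =
     pre_digraph.scc_of (with_proj (drive_graph I) \<restriction> (anchorsD I - V)) (entrance I)"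

definition far_side :: "parking_lot \<Rightarrow> cell set \<Rightarrow> cell set" where
  "far_side I V = anchorsD I - (entrance_component I V \<union> V)"

text \<open>
  Removing a cut set \<open>V\<close> leaves two parts without arcs between them: the component of the
  entrance and the remainder \<open>far_side I V\<close>, which has to be nonempty.
  As usual for vertex separators the remainder need not itself be connected. If it had to be,
  then for \<open>D\<close> consisting of a cell \<open>c\<close> and three of its neighbours there would be no cut set
  separating the entrance, placed at one of these neighbours, from either of the other two:
  removing \<open>c\<close> leaves three components, and a larger set violates the adjacency requirement.
  The cut constraints would then admit unconnected driving fields that the flow excludes.
\<close>

definition vertex_cut_sets :: "parking_lot \<Rightarrow> cell set set" where
  "vertex_cut_sets I =
     {V. V \<subseteq> anchorsD I \<and> entrance I \<notin> V \<and> far_side I V \<noteq> {} \<and>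
         (\<forall>v\<in>V. \<exists>w\<in>far_side I V. share_side v w)}"

definition ccc_constraints ::
  "parking_lot \<Rightarrow> (cell \<Rightarrow> real) \<Rightarrow> (cell \<Rightarrow> real) \<Rightarrow> (cell \<Rightarrow> real) \<Rightarrow> bool" where
  "ccc_constraints I x0 x90 y \<longleftrightarrow>
     (\<forall>V \<in> vertex_cut_sets I. \<forall>c \<in> far_side I V. \<forall>d \<in> coverD_within I (far_side I V) c.
        y d + (\<Sum>a\<in>cover0_within I (far_side I V \<union> V) c. x0 a)
            + (\<Sum>a\<in>cover90_within I (far_side I V \<union> V) c. x90 a)
        \<le> (\<Sum>v\<in>V. y v))"

definition ccc_feasible ::
  "parking_lot \<Rightarrow> (cell \<Rightarrow> real) \<Rightarrow> (cell \<Rightarrow> real) \<Rightarrow> (cell \<Rightarrow> real) \<Rightarrow> bool" where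
  "ccc_feasible I x0 x90 y \<longleftrightarrow>
     binary_vector I x0 x90 y \<and>
     packing_constraints I x0 x90 y \<and>
     access_constraints I x0 x90 y \<and>
     ccc_constraints I x0 x90 y \<and>
     fixing_constraints I y"

end

theory Submission
  imports Defs
begin

text \<open>
  Fix a binary vector that satisfies the packing, access and fixing constraints, and let \<open>Y\<close> be the set
  of used driving anchors, those with \<open>y = 1\<close>. Each formulation turns out to say the same thing
  about \<open>Y\<close>, namely \<open>driving_connected\<close>: every cell of \<open>Y\<close> reaches the entrance by a path that
  stays in \<open>Y\<close>. The theorem follows by comparing each formulation with this condition.

  Flow. The capacities confine the flow to arcs inside \<open>Y\<close>. If the cells of \<open>Y\<close> that do not reach
  the entrance formed a nonempty set \<open>S\<close>, then no flow could leave \<open>S\<close>, although each cell of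
  \<open>S\<close> injects one unit (\<open>net_outflow_nonpos_if_closed\<close>). Conversely, if \<open>Y\<close> is connected,
  send one unit from each cell of \<open>Y\<close> other than the entrance along a shortest path. Shortest
  paths traverse no arc twice and never leave the entrance, so the superposition
  (\<open>gathering_flow_exists\<close>) has arc values at most \<open>|Y| - 1\<close>, which respects the capacity
  \<open>M = |D| - 1\<close>, and delivers \<open>|Y| - 1\<close> units to the entrance.

  Cuts. By the packing constraints the left-hand side of a cut constraint is at most 1, so that
  the constraint only bites if the cut set \<open>V\<close> contains no used cell. In that case connectedness
  puts all of \<open>Y\<close> on the entrance side; the driving term vanishes, and so does every parking
  variable in the constraint, since all its access anchors lie in the unused set
  \<open>far_side I V \<union> V\<close>. Conversely, if some used cell \<open>d\<close> is not connected to the entrance, the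
  unused cells that border the connected part of \<open>Y\<close> contain a vertex cut set whose far side
  contains \<open>d\<close> (\<open>unused_cut_exists\<close>), and the cut constraint for \<open>d\<close> reads \<open>1 \<le> 0\<close>.
\<close>

section \<open>Flows towards a sink\<close>

text \<open>
  Summed over \<open>S\<close>, the flow on arcs inside \<open>S\<close> cancels; what remains is minus the flow that
  enters \<open>S\<close>.
\<close>

lemma net_outflow_nonpos_if_closed:
  fixes f :: "'a \<times> 'a \<Rightarrow> real"
  assumes "finite A" "finite S"
    and nonneg: "\<And>p. p \<in> A \<Longrightarrow> 0 \<le> f p"
    and closed: "\<And>a b. a \<in> S \<Longrightarrow> b \<notin> S \<Longrightarrow> (a, b) \<in> A \<Longrightarrow> f (a, b) = 0"
  shows "(\<Sum>a\<in>S. (\<Sum>b | (a, b) \<in> A. f (a, b)) - (\<Sum>b | (b, a) \<in> A. f (b, a))) \<le> 0"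
proof -
  have fin_out: "finite {b. (a, b) \<in> A}" for a
    using finite_Image[OF \<open>finite A\<close>, of "{a}"] by (simp add: Image_def)
  have fin_in: "finite {b. (b, a) \<in> A}" for a
    using finite_Image[of "A\<inverse>" "{a}"] \<open>finite A\<close> by (simp add: Image_def)
  have "(\<Sum>a\<in>S. \<Sum>b | (a, b) \<in> A. f (a, b)) = (\<Sum>a\<in>S. \<Sum>b | b \<in> S \<and> (a, b) \<in> A. f (a, b))"
    using closed by (intro sum.cong refl sum.mono_neutral_right fin_out) auto
  also have "\<dots> = (\<Sum>b\<in>S. \<Sum>a | a \<in> S \<and> (a, b) \<in> A. f (a, b))"
    using \<open>finite S\<close> by (intro sum.swap_restrict)
  also have "\<dots> \<le> (\<Sum>b\<in>S. \<Sum>a | (a, b) \<in> A. f (a, b))"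
    using nonneg by (intro sum_mono sum_mono2 fin_in) auto
  finally show ?thesis
    by (simp add: sum_subtractf)
qed

text \<open>
  Each node \<open>a\<close> other than the sink \<open>e\<close> supplies \<open>s a\<close>, and \<open>v\<close> units arrive at \<open>e\<close>. Since
  the inflow of \<open>e\<close> is prescribed, and not its net inflow, no flow circulates through \<open>e\<close> when \<open>v\<close>
  is the total supply.
\<close>

definition routes_to ::
  "('a \<times> 'a) set \<Rightarrow> ('a \<times> 'a) set \<Rightarrow> 'a \<Rightarrow> ('a \<Rightarrow> real) \<Rightarrow> real \<Rightarrow> ('a \<times> 'a \<Rightarrow> real) \<Rightarrow> bool"
where
  "routes_to A R e s v f \<longleftrightarrow>
     (\<forall>p. 0 \<le> f p) \<and> (\<forall>p. p \<notin> R \<longrightarrow> f p = 0) \<and>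
     (\<forall>a. a \<noteq> e \<longrightarrow> (\<Sum>b | (a, b) \<in> A. f (a, b)) - (\<Sum>b | (b, a) \<in> A. f (b, a)) = s a) \<and>
     (\<Sum>b | (b, e) \<in> A. f (b, e)) = v"

lemma routes_toD:
  assumes "routes_to A R e s v f"
  shows "0 \<le> f p" and "p \<notin> R \<Longrightarrow> f p = 0"
    and "a \<noteq> e \<Longrightarrow> (\<Sum>b | (a, b) \<in> A. f (a, b)) - (\<Sum>b | (b, a) \<in> A. f (b, a)) = s a"
    and "(\<Sum>b | (b, e) \<in> A. f (b, e)) = v"
  using assms unfolding routes_to_def by blast+

text \<open>
  The flow follows a shortest path from \<open>d\<close>, built backwards from \<open>e\<close>. Prepending an arc keeps
  the values at most 1 because its tail is farther from \<open>e\<close> than the tail of every arc used so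
  far; the induction therefore carries a bound on these distances.
\<close>

lemma unit_flow_exists:
  fixes d e :: 'a
  assumes "finite A" "R \<subseteq> A" "(d, e) \<in> R\<^sup>*"
  shows "\<exists>g. routes_to A R e (\<lambda>a. of_bool (a = d)) (of_bool (d \<noteq> e)) g \<and> (\<forall>p. g p \<le> 1)"
proof -
  define dist where "dist a = (LEAST n. (a, e) \<in> R ^^ n)" for a
  have fin_out: "finite {b. (a, b) \<in> A}" for a
    using finite_Image[OF \<open>finite A\<close>, of "{a}"] by (simp add: Image_def)
  have fin_in: "finite {b. (b, a) \<in> A}" for a
    using finite_Image[of "A\<inverse>" "{a}"] \<open>finite A\<close> by (simp add: Image_def)
  have "\<exists>g. routes_to A R e (\<lambda>a. of_bool (a = d)) (of_bool (d \<noteq> e)) g \<and> (\<forall>p. g p \<le> 1) \<and>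
      (\<forall>a b. dist d < dist a \<longrightarrow> g (a, b) = 0)"
    using \<open>(d, e) \<in> R\<^sup>*\<close>
  proof (induction "dist d" arbitrary: d rule: less_induct)
    case less
    show ?case
    proof (cases "d = e")
      case True
      then show ?thesis
        by (intro exI[of _ "\<lambda>_. 0"]) (auto simp: routes_to_def)
    next
      case False
      have "(d, e) \<in> R ^^ dist d"
        unfolding dist_def using less.prems by (auto intro: LeastI dest: rtrancl_imp_relpow)
      with False obtain n where "dist d = Suc n"
        by (cases "dist d") auto
      with \<open>(d, e) \<in> R ^^ dist d\<close> obtain c where c: "(d, c) \<in> R" "(c, e) \<in> R ^^ n"
        by (metis relpow_Suc_D2)
      have "dist c \<le> n"
        unfolding dist_def by (rule Least_le) (rule c)
      with \<open>dist d = Suc n\<close> have "dist c < dist d"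
        by simp
      from less.hyps[OF this relpow_imp_rtrancl[OF c(2)]]
      obtain g where g: "routes_to A R e (\<lambda>a. of_bool (a = c)) (of_bool (c \<noteq> e)) g"
        and g1: "\<forall>p. g p \<le> 1" and gdist: "\<forall>a b. dist c < dist a \<longrightarrow> g (a, b) = 0"
        by (elim exE conjE)
      define h where "h p = g p + of_bool (p = (d, c))" for p
      have "(d, c) \<in> A"
        using c assms by auto
      have out: "(\<Sum>b | (a, b) \<in> A. h (a, b)) = (\<Sum>b | (a, b) \<in> A. g (a, b)) + of_bool (a = d)" for a
      proof -
        have "(\<Sum>b | (a, b) \<in> A. of_bool ((a, b) = (d, c)) :: real) = of_bool (a = d)"
          using \<open>(d, c) \<in> A\<close> fin_out[of a] by (cases "a = d") (auto simp: of_bool_def)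
        then show ?thesis
          by (simp add: h_def sum.distrib)
      qed
      have inflow: "(\<Sum>b | (b, a) \<in> A. h (b, a)) = (\<Sum>b | (b, a) \<in> A. g (b, a)) + of_bool (a = c)" for a
      proof -
        have "(\<Sum>b | (b, a) \<in> A. of_bool ((b, a) = (d, c)) :: real) = of_bool (a = c)"
          using \<open>(d, c) \<in> A\<close> fin_in[of a] by (cases "a = c") (auto simp: of_bool_def)
        then show ?thesis
          by (simp add: h_def sum.distrib)
      qed
      have "routes_to A R e (\<lambda>a. of_bool (a = d)) (of_bool (d \<noteq> e)) h"
        unfolding routes_to_def
      proof (intro conjI allI impI)
        show "0 \<le> h p" for p
          using routes_toD(1)[OF g, of p] by (simp add: h_def)
        show "h p = 0" if "p \<notin> R" for p
          using routes_toD(2)[OF g that] that c(1) by (auto simp: h_def)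
        show "(\<Sum>b | (a, b) \<in> A. h (a, b)) - (\<Sum>b | (b, a) \<in> A. h (b, a)) = of_bool (a = d)"
          if "a \<noteq> e" for a
        proof -
          have "(\<Sum>b | (a, b) \<in> A. g (a, b)) - (\<Sum>b | (b, a) \<in> A. g (b, a)) = of_bool (a = c)"
            by (rule routes_toD(3)[OF g that])
          then show ?thesis
            unfolding out inflow by linarith
        qed
        have "(\<Sum>b | (b, e) \<in> A. g (b, e)) = of_bool (c \<noteq> e)"
          by (rule routes_toD(4)[OF g])
        then show "(\<Sum>b | (b, e) \<in> A. h (b, e)) = of_bool (d \<noteq> e)"
          unfolding inflow using False by auto
      qed
      moreover have "\<forall>p. h p \<le> 1"
        using g1 gdist \<open>dist c < dist d\<close> by (simp add: h_def)
      moreover have "\<forall>a b. dist d < dist a \<longrightarrow> h (a, b) = 0"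
        using gdist \<open>dist c < dist d\<close> by (auto simp: h_def)
      ultimately show ?thesis
        by blast
    qed
  qed
  then show ?thesis
    by blast
qed

text \<open>
  The superposition of the unit flows of the nodes of \<open>Y - {e}\<close>: each of these \<open>|Y| - 1\<close> flows adds
  at most 1 to the value of an arc.
\<close>

lemma gathering_flow_exists:
  fixes e :: 'a
  assumes "finite A" "R \<subseteq> A" "finite Y" "e \<in> Y" and reach: "\<And>d. d \<in> Y \<Longrightarrow> (d, e) \<in> R\<^sup>*"
  shows "\<exists>f. routes_to A R e (\<lambda>a. of_bool (a \<in> Y)) (real (card Y) - 1) f \<and>
    (\<forall>p. f p \<le> real (card Y) - 1)"
proof -
  obtain g where g: "\<And>d. d \<in> Y \<Longrightarrow>
      routes_to A R e (\<lambda>a. of_bool (a = d)) (of_bool (d \<noteq> e)) (g d)"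
    and g1: "\<And>d p. d \<in> Y \<Longrightarrow> g d p \<le> 1"
    using unit_flow_exists[OF assms(1,2) reach] by metis
  define f where "f p = (\<Sum>d\<in>Y - {e}. g d p)" for p
  have "card Y = Suc (card (Y - {e}))"
    using \<open>finite Y\<close> \<open>e \<in> Y\<close> by (rule card.remove)
  then have card: "real (card (Y - {e})) = real (card Y) - 1"
    by simp
  have "f p \<le> real (card Y) - 1" for p
    unfolding f_def card[symmetric] using sum_bounded_above[of "Y - {e}" "\<lambda>d. g d p" 1] g1 by auto
  moreover have "routes_to A R e (\<lambda>a. of_bool (a \<in> Y)) (real (card Y) - 1) f"
    unfolding routes_to_def
  proof (intro conjI allI impI)
    show "0 \<le> f p" for p
      unfolding f_def using routes_toD(1)[OF g] by (intro sum_nonneg) auto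
    show "f p = 0" if "p \<notin> R" for p
      unfolding f_def using routes_toD(2)[OF g that] by (intro sum.neutral) auto
    show "(\<Sum>b | (a, b) \<in> A. f (a, b)) - (\<Sum>b | (b, a) \<in> A. f (b, a)) = of_bool (a \<in> Y)"
      if "a \<noteq> e" for a
    proof -
      have "(\<Sum>b | (a, b) \<in> A. f (a, b)) - (\<Sum>b | (b, a) \<in> A. f (b, a))
        = (\<Sum>d\<in>Y - {e}. (\<Sum>b | (a, b) \<in> A. g d (a, b)) - (\<Sum>b | (b, a) \<in> A. g d (b, a)))"
        unfolding f_def sum_subtractf by (intro arg_cong2[where f = "(-)"] sum.swap)
      also have "\<dots> = (\<Sum>d\<in>Y - {e}. of_bool (a = d))"
        using routes_toD(3)[OF g that] by (intro sum.cong) auto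
      also have "\<dots> = of_bool (a \<in> Y)"
        using \<open>finite Y\<close> that by (auto simp: of_bool_def)
      finally show ?thesis .
    qed
    have "(\<Sum>b | (b, e) \<in> A. f (b, e)) = (\<Sum>d\<in>Y - {e}. \<Sum>b | (b, e) \<in> A. g d (b, e))"
      unfolding f_def by (rule sum.swap)
    also have "\<dots> = (\<Sum>d\<in>Y - {e}. 1)"
      using routes_toD(4)[OF g] by (intro sum.cong) auto
    finally show "(\<Sum>b | (b, e) \<in> A. f (b, e)) = real (card Y) - 1"
      using card by simp
  qed
  ultimately show ?thesis
    by blast
qed

section \<open>Connected driving fields\<close>

definition used_anchors :: "parking_lot \<Rightarrow> (cell \<Rightarrow> real) \<Rightarrow> cell set" where
  "used_anchors I y = {d \<in> anchorsD I. y d = 1}"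

definition arcs_within :: "parking_lot \<Rightarrow> cell set \<Rightarrow> (cell \<times> cell) set" where
  "arcs_within I S = drive_arcs I \<inter> S \<times> S"

definition driving_connected :: "parking_lot \<Rightarrow> (cell \<Rightarrow> real) \<Rightarrow> bool" where
  "driving_connected I y \<longleftrightarrow>
     (\<forall>d\<in>used_anchors I y. (d, entrance I) \<in> (arcs_within I (used_anchors I y))\<^sup>*)"

lemma finite_anchors:
  assumes "two_way_instance I"
  shows "finite (anchors0 I)" "finite (anchors90 I)" "finite (anchorsD I)"
proof -
  have "finite (lot I)"
    by (simp add: lot_def)
  moreover have "anchors0 I \<subseteq> lot I" "anchors90 I \<subseteq> lot I" "anchorsD I \<subseteq> lot I"
    using assms by (simp_all add: two_way_instance_def)
  ultimately show "finite (anchors0 I)" "finite (anchors90 I)" "finite (anchorsD I)"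
    by (simp_all only: finite_subset)
qed

lemma finite_drive_arcs:
  assumes "two_way_instance I"
  shows "finite (drive_arcs I)"
proof (rule finite_subset)
  show "drive_arcs I \<subseteq> anchorsD I \<times> anchorsD I"
    by (auto simp: drive_arcs_def)
qed (simp add: finite_anchors(3)[OF assms])

lemma finite_used_anchors:
  assumes "two_way_instance I"
  shows "finite (used_anchors I y)"
  using finite_anchors(3)[OF assms] by (simp add: used_anchors_def)

lemma share_side_commute: "share_side a b \<longleftrightarrow> share_side b a"
  by (cases a; cases b) (auto simp: abs_minus_commute)

lemma sym_arcs_within: "sym (arcs_within I S)"
  using share_side_commute by (fastforce simp: sym_def arcs_within_def drive_arcs_def)

lemma arcs_within_mono: "S \<subseteq> T \<Longrightarrow> arcs_within I S \<subseteq> arcs_within I T"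
  by (auto simp: arcs_within_def)

lemma used_anchors_unused:
  assumes "binary_vector I x0 x90 y" "d \<in> anchorsD I" "d \<notin> used_anchors I y"
  shows "y d = 0"
  using assms by (auto simp: binary_vector_def used_anchors_def)

lemma sum_driving_eq_card:
  assumes "two_way_instance I" "binary_vector I x0 x90 y"
  shows "(\<Sum>d\<in>anchorsD I. y d) = real (card (used_anchors I y))"
proof -
  have "(\<Sum>d\<in>anchorsD I. y d) = (\<Sum>d\<in>used_anchors I y. y d)"
    using finite_anchors(3)[OF assms(1)] used_anchors_unused[OF assms(2)]
    by (intro sum.mono_neutral_right) (auto simp: used_anchors_def)
  also have "\<dots> = real (card (used_anchors I y))"
    by (simp add: used_anchors_def)
  finally show ?thesis .
qed

lemma entrance_used:
  assumes "two_way_instance I" "fixing_constraints I y"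
  shows "entrance I \<in> used_anchors I y"
  using assms by (auto simp: two_way_instance_def fixing_constraints_def used_anchors_def)

section \<open>Flow constraints and connectedness\<close>

lemma driving_connected_if_flow:
  assumes inst: "two_way_instance I" and bin: "binary_vector I x0 x90 y"
    and flow: "flow_constraints I y f"
  shows "driving_connected I y"
proof -
  let ?Y = "used_anchors I y" and ?e = "entrance I"
  \<comment> \<open>Each cell of \<open>S\<close> supplies one unit, but an arc leaving \<open>S\<close> has an unused head and capacity 0.\<close>
  define S where "S = {d \<in> ?Y. (d, ?e) \<notin> (arcs_within I ?Y)\<^sup>*}"
  have nonneg: "0 \<le> f p" if "p \<in> drive_arcs I" for p
    using flow that by (simp add: flow_constraints_def)
  have vanish: "f (a, b) = 0" if arc: "(a, b) \<in> drive_arcs I" and unused: "b \<notin> ?Y" for a b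
  proof -
    have "y b = 0"
      using arc unused by (intro used_anchors_unused[OF bin]) (auto simp: drive_arcs_def)
    with flow arc have "f (a, b) \<le> 0"
      by (fastforce simp: flow_constraints_def)
    with nonneg[OF arc] show ?thesis by simp
  qed
  have closed: "f (a, b) = 0" if "a \<in> S" "b \<notin> S" "(a, b) \<in> drive_arcs I" for a b
  proof (cases "b \<in> ?Y")
    case True
    with that have "(b, ?e) \<in> (arcs_within I ?Y)\<^sup>*" "(a, b) \<in> arcs_within I ?Y"
      by (auto simp: S_def arcs_within_def)
    then have "(a, ?e) \<in> (arcs_within I ?Y)\<^sup>*"
      by (rule converse_rtrancl_into_rtrancl[rotated])
    with \<open>a \<in> S\<close> show ?thesis
      by (simp add: S_def)
  qed (use that vanish in blast)
  have "finite S"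
    using finite_used_anchors[OF inst] by (simp add: S_def)
  have "(\<Sum>b | (a, b) \<in> drive_arcs I. f (a, b)) - (\<Sum>b | (b, a) \<in> drive_arcs I. f (b, a)) = 1"
    if "a \<in> S" for a
  proof -
    have "a \<noteq> ?e" "a \<in> anchorsD I" "y a = 1"
      using that by (auto simp: S_def used_anchors_def)
    then show ?thesis
      using flow by (auto simp: flow_constraints_def out_heads_def in_tails_def)
  qed
  then have "real (card S) =
    (\<Sum>a\<in>S. (\<Sum>b | (a, b) \<in> drive_arcs I. f (a, b)) - (\<Sum>b | (b, a) \<in> drive_arcs I. f (b, a)))"
    by simp
  also have "\<dots> \<le> 0"
    by (rule net_outflow_nonpos_if_closed)
      (use finite_drive_arcs[OF inst] \<open>finite S\<close> nonneg closed in blast)+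
  finally have "S = {}"
    using \<open>finite S\<close> by simp
  then show ?thesis
    by (auto simp: driving_connected_def S_def)
qed

lemma flow_if_driving_connected:
  assumes inst: "two_way_instance I" and bin: "binary_vector I x0 x90 y"
    and fixing: "fixing_constraints I y" and conn: "driving_connected I y"
  shows "\<exists>f. flow_constraints I y f"
proof -
  let ?Y = "used_anchors I y" and ?e = "entrance I"
  have sub: "arcs_within I ?Y \<subseteq> drive_arcs I"
    by (auto simp: arcs_within_def)
  obtain f where f: "routes_to (drive_arcs I) (arcs_within I ?Y) ?e
      (\<lambda>a. of_bool (a \<in> ?Y)) (real (card ?Y) - 1) f"
    and f_le: "\<And>p. f p \<le> real (card ?Y) - 1"
    using gathering_flow_exists[OF finite_drive_arcs[OF inst] sub finite_used_anchors[OF inst]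
        entrance_used[OF inst fixing]] conn
    unfolding driving_connected_def by blast
  have y: "y a = of_bool (a \<in> ?Y)" if "a \<in> anchorsD I" for a
    using that used_anchors_unused[OF bin that] by (auto simp: used_anchors_def)
  have "card ?Y \<le> card (anchorsD I)"
    using finite_anchors(3)[OF inst] by (intro card_mono) (auto simp: used_anchors_def)
  then have le: "f p \<le> real (card (anchorsD I)) - 1" for p
    using f_le[of p] by linarith
  have cap: "f (a, b) \<le> (real (card (anchorsD I)) - 1) * y a \<and>
        f (a, b) \<le> (real (card (anchorsD I)) - 1) * y b" if "(a, b) \<in> drive_arcs I" for a b
  proof (cases "(a, b) \<in> arcs_within I ?Y")
    case True
    then show ?thesis
      using le[of "(a, b)"] by (auto simp: arcs_within_def used_anchors_def)
  next
    case False
    have "0 \<le> real (card (anchorsD I)) - 1"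
      using routes_toD(1)[OF f, of "(a, b)"] le[of "(a, b)"] by linarith
    moreover have "f (a, b) = 0"
      by (rule routes_toD(2)[OF f False])
    ultimately show ?thesis
      using that y[of a] y[of b] by (auto simp: drive_arcs_def)
  qed
  have "flow_constraints I y f"
    unfolding flow_constraints_def out_heads_def in_tails_def mem_Collect_eq
      sum_driving_eq_card[OF inst bin]
    using cap routes_toD(1)[OF f] routes_toD(3)[OF f] routes_toD(4)[OF f] y
    by (intro conjI ballI case_prodI2) simp_all
  then show ?thesis
    by (rule exI[of _ f])
qed

section \<open>Cut constraints and connectedness\<close>

text \<open>Arcs come in both directions, so reaching the entrance already means strong connectivity.\<close>

lemma entrance_component_iff:
  assumes "entrance I \<in> anchorsD I - V"
  shows "v \<in> entrance_component I V \<longleftrightarrow> (v, entrance I) \<in> (arcs_within I (anchorsD I - V))\<^sup>*"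
proof -
  let ?H = "with_proj (drive_graph I) \<restriction> (anchorsD I - V)"
  have ends: "arcs_ends ?H = arcs_within I (anchorsD I - V)"
    by (auto simp: drive_graph_def arcs_within_def arcs_ends_conv)
  have reach: "a \<rightarrow>\<^sup>*\<^bsub>?H\<^esub> b \<longleftrightarrow> (a, b) \<in> (arcs_within I (anchorsD I - V))\<^sup>*"
    if "b \<in> anchorsD I - V" for a b
  proof
    assume "a \<rightarrow>\<^sup>*\<^bsub>?H\<^esub> b"
    then show "(a, b) \<in> (arcs_within I (anchorsD I - V))\<^sup>*"
      using reachable_rtranclI ends by metis
  next
    assume "(a, b) \<in> (arcs_within I (anchorsD I - V))\<^sup>*"
    then show "a \<rightarrow>\<^sup>*\<^bsub>?H\<^esub> b"
    proof (induction rule: converse_rtrancl_induct)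
      case base
      show ?case
        using that by (simp add: reachable_def)
    next
      case (step a c)
      then show ?case
        unfolding reachable_def ends
        by (auto intro: converse_rtrancl_on_into_rtrancl_on simp: arcs_within_def)
    qed
  qed
  have "v \<in> anchorsD I - V"
    if "(v, entrance I) \<in> (arcs_within I (anchorsD I - V))\<^sup>*" for v
    using that assms by (cases rule: converse_rtranclE) (auto simp: arcs_within_def)
  moreover have "(entrance I, v) \<in> (arcs_within I (anchorsD I - V))\<^sup>* \<longleftrightarrow>
      (v, entrance I) \<in> (arcs_within I (anchorsD I - V))\<^sup>*"
    using sym_rtrancl[OF sym_arcs_within, of I "anchorsD I - V"] by (auto elim: symE)
  ultimately show ?thesis
    using reach assms unfolding entrance_component_def pre_digraph.scc_of_def by blast
qed

text \<open>
  The boundary \<open>B\<close> of the connected part \<open>C\<close> consists of unused cells and separates \<open>C\<close> from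
  the remaining cells \<open>F\<close>, but a cell of \<open>B\<close> may have no neighbour in \<open>F\<close>, which a vertex cut
  set must not contain. Dropping such cells opens no way into \<open>F\<close>, as they do not border on it.
\<close>

lemma unused_cut_exists:
  assumes inst: "two_way_instance I" and bin: "binary_vector I x0 x90 y"
    and fixing: "fixing_constraints I y"
    and d: "d \<in> used_anchors I y" "(d, entrance I) \<notin> (arcs_within I (used_anchors I y))\<^sup>*"
  obtains V where "V \<in> vertex_cut_sets I" "V \<inter> used_anchors I y = {}" "d \<in> far_side I V"
proof -
  let ?Y = "used_anchors I y" and ?e = "entrance I"
  define C where "C = {a \<in> ?Y. (a, ?e) \<in> (arcs_within I ?Y)\<^sup>*}"
  define B where "B = {b \<in> anchorsD I - C. \<exists>a\<in>C. (b, a) \<in> drive_arcs I}"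
  define F where "F = anchorsD I - (C \<union> B)"
  define V where "V = {v \<in> B. \<exists>w\<in>F. share_side v w}"
  have "?e \<in> C"
    using entrance_used[OF inst fixing] by (simp add: C_def)
  have B_unused: "b \<notin> ?Y" if "b \<in> B" for b
  proof
    assume "b \<in> ?Y"
    from \<open>b \<in> B\<close> obtain a where a: "a \<in> C" "(b, a) \<in> drive_arcs I" and "b \<notin> C"
      by (auto simp: B_def)
    from a \<open>b \<in> ?Y\<close> have "(b, a) \<in> arcs_within I ?Y"
      by (auto simp: C_def arcs_within_def)
    with a \<open>b \<in> ?Y\<close> have "b \<in> C"
      by (auto simp: C_def intro: converse_rtrancl_into_rtrancl)
    with \<open>b \<notin> C\<close> show False ..
  qed
  have "V \<subseteq> B" "B \<subseteq> anchorsD I" "C \<subseteq> ?Y" "?Y \<subseteq> anchorsD I"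
    by (auto simp: V_def B_def C_def used_anchors_def)
  have "d \<in> F"
    using d B_unused \<open>?Y \<subseteq> anchorsD I\<close> unfolding F_def C_def by blast
  have e: "?e \<in> anchorsD I - V"
    using \<open>?e \<in> C\<close> \<open>V \<subseteq> B\<close> \<open>C \<subseteq> ?Y\<close> \<open>?Y \<subseteq> anchorsD I\<close> B_unused by blast
  have "F \<inter> entrance_component I V = {}"
  proof -
    have "v \<notin> F" if "(v, ?e) \<in> (arcs_within I (anchorsD I - V))\<^sup>*" for v
      using that
    proof (induction rule: converse_rtrancl_induct)
      case base
      show ?case
        using \<open>?e \<in> C\<close> by (simp add: F_def)
    next
      case (step a b)
      show ?case
      proof
        assume "a \<in> F"
        from step.hyps(1) have arc: "(a, b) \<in> drive_arcs I" "b \<in> anchorsD I" "b \<notin> V"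
          by (auto simp: arcs_within_def)
        have "b \<notin> C"
          using arc(1) \<open>a \<in> F\<close> by (auto simp: F_def B_def)
        moreover have "b \<notin> B"
          using arc \<open>a \<in> F\<close> share_side_commute unfolding V_def drive_arcs_def by blast
        ultimately show False
          using step.IH arc(2) by (simp add: F_def)
      qed
    qed
    then show ?thesis
      using entrance_component_iff[OF e] by blast
  qed
  moreover have "F \<inter> V = {}"
    using \<open>V \<subseteq> B\<close> by (auto simp: F_def)
  ultimately have "F \<subseteq> far_side I V"
    by (auto simp: F_def far_side_def)
  moreover have "V \<in> vertex_cut_sets I"
    unfolding vertex_cut_sets_def
    using \<open>F \<subseteq> far_side I V\<close> \<open>d \<in> F\<close> e \<open>V \<subseteq> B\<close> \<open>B \<subseteq> anchorsD I\<close> by (auto simp: V_def)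
  ultimately show thesis
    using that \<open>d \<in> F\<close> \<open>V \<subseteq> B\<close> B_unused by blast
qed

lemma binary_nonneg:
  assumes "binary_vector I x0 x90 y"
  shows "a \<in> anchors0 I \<Longrightarrow> 0 \<le> x0 a" "a \<in> anchors90 I \<Longrightarrow> 0 \<le> x90 a"
    "a \<in> anchorsD I \<Longrightarrow> 0 \<le> y a"
  using assms by (fastforce simp: binary_vector_def)+

lemma driving_connected_if_ccc:
  assumes inst: "two_way_instance I" and bin: "binary_vector I x0 x90 y"
    and fixing: "fixing_constraints I y" and ccc: "ccc_constraints I x0 x90 y"
  shows "driving_connected I y"
proof (rule ccontr)
  assume "\<not> driving_connected I y"
  then obtain d where d: "d \<in> used_anchors I y"
      "(d, entrance I) \<notin> (arcs_within I (used_anchors I y))\<^sup>*"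
    by (auto simp: driving_connected_def)
  then obtain V where V: "V \<in> vertex_cut_sets I" "V \<inter> used_anchors I y = {}" "d \<in> far_side I V"
    by (rule unused_cut_exists[OF inst bin fixing])
  have "0 < drive_size I"
    using inst by (simp add: two_way_instance_def)
  \<comment> \<open>The field anchored at \<open>d\<close> contains \<open>d\<close>, so the cut constraint applies with \<open>c = d\<close>.\<close>
  then have "d \<in> coverD_within I (far_side I V) d"
    using V(3) by (cases d) (simp add: coverD_within_def coverD_def far_side_def)
  then have "y d + (\<Sum>a\<in>cover0_within I (far_side I V \<union> V) d. x0 a)
      + (\<Sum>a\<in>cover90_within I (far_side I V \<union> V) d. x90 a) \<le> (\<Sum>v\<in>V. y v)"
    using ccc V by (auto simp: ccc_constraints_def)
  moreover have "0 \<le> (\<Sum>a\<in>cover0_within I (far_side I V \<union> V) d. x0 a)"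
    using binary_nonneg(1)[OF bin]
    by (intro sum_nonneg) (auto simp: cover0_within_def cover0_def)
  moreover have "0 \<le> (\<Sum>a\<in>cover90_within I (far_side I V \<union> V) d. x90 a)"
    using binary_nonneg(2)[OF bin]
    by (intro sum_nonneg) (auto simp: cover90_within_def cover90_def)
  moreover have "(\<Sum>v\<in>V. y v) = 0"
    using V used_anchors_unused[OF bin] by (intro sum.neutral) (auto simp: vertex_cut_sets_def)
  moreover have "y d = 1"
    using d by (simp add: used_anchors_def)
  ultimately show False
    by linarith
qed

text \<open>A path inside the used cells cannot cross an unused cut set.\<close>

lemma used_anchors_on_entrance_side:
  assumes inst: "two_way_instance I" and conn: "driving_connected I y"
    and V: "V \<in> vertex_cut_sets I" "V \<inter> used_anchors I y = {}"
  shows "used_anchors I y \<inter> (far_side I V \<union> V) = {}"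
proof -
  have e: "entrance I \<in> anchorsD I - V"
    using inst V by (auto simp: two_way_instance_def vertex_cut_sets_def)
  have "used_anchors I y \<subseteq> anchorsD I - V"
    using V by (auto simp: used_anchors_def)
  then have "(arcs_within I (used_anchors I y))\<^sup>* \<subseteq> (arcs_within I (anchorsD I - V))\<^sup>*"
    by (intro rtrancl_mono arcs_within_mono)
  then have "used_anchors I y \<subseteq> entrance_component I V"
    using conn entrance_component_iff[OF e] by (auto simp: driving_connected_def)
  then show ?thesis
    using V by (auto simp: far_side_def)
qed

lemma ccc_if_driving_connected:
  assumes inst: "two_way_instance I" and bin: "binary_vector I x0 x90 y"
    and pack: "packing_constraints I x0 x90 y" and access: "access_constraints I x0 x90 y"
    and conn: "driving_connected I y"
  shows "ccc_constraints I x0 x90 y"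
  unfolding ccc_constraints_def
proof (intro ballI)
  fix V c d
  assume V: "V \<in> vertex_cut_sets I" and c: "c \<in> far_side I V"
    and d: "d \<in> coverD_within I (far_side I V) c"
  let ?S = "far_side I V \<union> V" and ?Y = "used_anchors I y"
  have VD: "V \<subseteq> anchorsD I" and SD: "?S \<subseteq> anchorsD I"
    using V by (auto simp: vertex_cut_sets_def far_side_def)
  have sub0: "cover0_within I ?S c \<subseteq> cover0 I c" and sub90: "cover90_within I ?S c \<subseteq> cover90 I c"
    and anch0: "cover0 I c \<subseteq> anchors0 I" and anch90: "cover90 I c \<subseteq> anchors90 I"
    by (auto simp: cover0_within_def cover90_within_def cover0_def cover90_def)
  show "y d + (\<Sum>a\<in>cover0_within I ?S c. x0 a) + (\<Sum>a\<in>cover90_within I ?S c. x90 a)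
    \<le> (\<Sum>v\<in>V. y v)"
  proof (cases "V \<inter> ?Y = {}")
    \<comment> \<open>A used cut cell makes the right-hand side at least 1, the packing bound at \<open>c\<close>.\<close>
    case False
    then obtain v where v: "v \<in> V" "y v = 1"
      by (auto simp: used_anchors_def)
    have "0 < drive_size I" "c \<in> anchorsD I" "\<forall>a\<in>anchorsD I. fieldD I a \<subseteq> lot I - blocked I"
      using inst c by (auto simp: two_way_instance_def far_side_def)
    then have "c \<in> lot I - blocked I"
      by (cases c) fastforce
    moreover have "d \<in> coverD I c"
      using d by (simp add: coverD_within_def)
    ultimately have "y d + (\<Sum>a\<in>cover0 I c. x0 a) + (\<Sum>a\<in>cover90 I c. x90 a) \<le> 1"
      using pack by (simp add: packing_constraints_def)
    moreover have "(\<Sum>a\<in>cover0_within I ?S c. x0 a) \<le> (\<Sum>a\<in>cover0 I c. x0 a)"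
      using sub0 anch0 binary_nonneg(1)[OF bin] finite_subset[OF anch0 finite_anchors(1)[OF inst]]
      by (intro sum_mono2) auto
    moreover have "(\<Sum>a\<in>cover90_within I ?S c. x90 a) \<le> (\<Sum>a\<in>cover90 I c. x90 a)"
      using sub90 anch90 binary_nonneg(2)[OF bin] finite_subset[OF anch90 finite_anchors(2)[OF inst]]
      by (intro sum_mono2) auto
    moreover have "y v \<le> (\<Sum>v\<in>V. y v)"
      using v VD binary_nonneg(3)[OF bin] finite_subset[OF VD finite_anchors(3)[OF inst]]
      by (intro member_le_sum) auto
    ultimately show ?thesis
      using v by linarith
  next
    \<comment> \<open>No used cell lies on the far side: every term vanishes.\<close>
    case True
    have unused: "y a = 0" if "a \<in> ?S" for a
      using used_anchors_on_entrance_side[OF inst conn V True] that SD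
      by (intro used_anchors_unused[OF bin]) auto
    have "x0 a \<le> 0" if "a \<in> cover0_within I ?S c" for a
    proof -
      have "x0 a \<le> (\<Sum>d\<in>access0 I a. y d)"
        using access that sub0 anch0 by (auto simp: access_constraints_def)
      also have "\<dots> = 0"
        using that unused by (intro sum.neutral) (auto simp: cover0_within_def)
      finally show ?thesis .
    qed
    then have "(\<Sum>a\<in>cover0_within I ?S c. x0 a) \<le> 0"
      by (rule sum_nonpos)
    moreover have "x90 a \<le> 0" if "a \<in> cover90_within I ?S c" for a
    proof -
      have "x90 a \<le> (\<Sum>d\<in>access90 I a. y d)"
        using access that sub90 anch90 by (auto simp: access_constraints_def)
      also have "\<dots> = 0"
        using that unused by (intro sum.neutral) (auto simp: cover90_within_def)
      finally show ?thesis .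
    qed
    then have "(\<Sum>a\<in>cover90_within I ?S c. x90 a) \<le> 0"
      by (rule sum_nonpos)
    moreover have "y d = 0"
      using d unused by (auto simp: coverD_within_def)
    moreover have "(\<Sum>v\<in>V. y v) = 0"
      using unused by simp
    ultimately show ?thesis
      by linarith
  qed
qed

theorem theorem1:
  fixes I :: parking_lot and x0 x90 y :: "cell \<Rightarrow> real"
  assumes "two_way_instance I"
    and "binary_vector I x0 x90 y"
  shows "(\<exists>f. flow_feasible I x0 x90 y f) \<longleftrightarrow> ccc_feasible I x0 x90 y"
proof
  assume "\<exists>f. flow_feasible I x0 x90 y f"
  then show "ccc_feasible I x0 x90 y"
    unfolding flow_feasible_def ccc_feasible_def
    using driving_connected_if_flow ccc_if_driving_connected assms by blast
next
  assume "ccc_feasible I x0 x90 y"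
  then show "\<exists>f. flow_feasible I x0 x90 y f"
    unfolding flow_feasible_def ccc_feasible_def
    using driving_connected_if_ccc flow_if_driving_connected assms by blast
qed

end
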